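(* Let $A$ be a multiplicative divisor system. Then there exists an arithmetical function $\phi_A:\mathbb N\to\mathbb C$ satisfying $$\sum_{d\in A(n)}\phi_A(d)=n\quad\text{for all } n\ge1$$ if and only if $n\in A(n)$ for all $n\in\mathbb N$. In this case the solution $\phi_A$ is unique, is multiplicative, and satisfies $1\le\phi_A(n)\le n$ for all $n\in\mathbb N$.
   Context: A divisor system $A$ assigns to each positive integer $n$ a set $A(n)$ of positive divisors of $n$. It is called multiplicative if not all $A(n)$ are empty and $A(n_1n_2)=A(n_1)A(n_2)=\{d_1d_2: d_1\in A(n_1),d_2\in A(n_2)\}$ whenever $\gcd(n_1,n_2)=1$. *)

theory Defs
  imports Complex_Main
begin

text \<open>
  Positive integers are modelled by \<^typ>\<open>nat\<close>, with all conditions restricted to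
  positive arguments; the values of divisor systems and arithmetical functions
  at \<open>0\<close> are irrelevant.
\<close>

definition divisor_system :: "(nat \<Rightarrow> nat set) \<Rightarrow> bool" where
  "divisor_system A \<longleftrightarrow> (\<forall>n>0. A n \<subseteq> {d. d dvd n})"

definition multiplicative_divisor_system :: "(nat \<Rightarrow> nat set) \<Rightarrow> bool" where
  "multiplicative_divisor_system A \<longleftrightarrow>
     divisor_system A \<and>
     (\<exists>n>0. A n \<noteq> {}) \<and>
     (\<forall>n1>0. \<forall>n2>0. coprime n1 n2 \<longrightarrow>
        A (n1 * n2) = {d1 * d2 | d1 d2. d1 \<in> A n1 \<and> d2 \<in> A n2})"

definition multiplicative_arith :: "(nat \<Rightarrow> complex) \<Rightarrow> bool" where
  "multiplicative_arith f \<longleftrightarrow>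
     (\<exists>n>0. f n \<noteq> 0) \<and>
     (\<forall>n1>0. \<forall>n2>0. coprime n1 n2 \<longrightarrow> f (n1 * n2) = f n1 * f n2)"

definition totient_solution :: "(nat \<Rightarrow> nat set) \<Rightarrow> (nat \<Rightarrow> complex) \<Rightarrow> bool" where
  "totient_solution A \<phi> \<longleftrightarrow> (\<forall>n>0. (\<Sum>d\<in>A n. \<phi> d) = of_nat n)"

end

theory Submission
  imports Defs "HOL-Computational_Algebra.Primes"
begin

text \<open>
  At a prime power the equation reads
  \<open>\<phi>(p^k) + (\<Sum>d\<in>A(p^k) - {p^k}. \<phi>(d)) = p^k\<close>, where the first summand is present only if
  \<open>p^k \<in> A(p^k)\<close>. By induction on \<open>k\<close> the remaining sum lies between \<open>0\<close> and
  \<open>1 + p + \<dots> + p^(k-1) < p^k\<close>, which forces both \<open>p^k \<in> A(p^k)\<close> and \<open>1 \<le> \<phi>(p^k) \<le> p^k\<close>.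
  Multiplicativity extends this to all \<open>n\<close>. Conversely, if \<open>n \<in> A(n)\<close> always holds, the equation
  determines \<open>\<phi>(n)\<close> recursively, and comparing the sum over \<open>A(mn)\<close> with the product of the sums
  over \<open>A(m)\<close> and \<open>A(n)\<close> shows that \<open>\<phi>\<close> is multiplicative.
\<close>

text \<open>Splitting off the full power of one prime divisor of \<open>n\<close> leaves a strictly
  smaller cofactor coprime to it, so strong induction applies.\<close>

lemma coprime_prime_power_induct [consumes 1, case_names prime_power mult]:
  fixes n :: nat
  assumes "n > 0"
    and prime_power: "\<And>p k. prime p \<Longrightarrow> P (p ^ k)"
    and mult: "\<And>a b. a > 0 \<Longrightarrow> b > 0 \<Longrightarrow> coprime a b \<Longrightarrow> P a \<Longrightarrow> P b \<Longrightarrow> P (a * b)"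
  shows "P n"
  using \<open>n > 0\<close>
proof (induction n rule: less_induct)
  case (less n)
  show ?case
  proof (cases "n = 1")
    case True
    \<comment> \<open>Here \<open>1\<close> counts as the prime power \<open>2 ^ 0\<close>, so no
      separate base case is required.\<close>
    then show ?thesis using prime_power[OF two_is_prime_nat, of 0] by simp
  next
    case False
    then obtain p where p: "prime p" "p dvd n"
      using prime_factor_nat by blast
    obtain r where r: "n = p ^ multiplicity p n * r" "\<not> p dvd r"
      using multiplicity_decompose'[of n p] less.prems p
      by (metis not_gr0 not_prime_unit)
    have r0: "r > 0" using r less.prems by (metis gr0I mult_0_right)
    have k: "multiplicity p n > 0"
      using p less.prems by (simp add: prime_multiplicity_gt_zero_iff)
    then have "p ^ multiplicity p n > 1"
      using prime_gt_1_nat[OF p(1)] one_less_power by blast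
    then have "r < n" using r(1) r0
      by (metis mult.commute mult.right_neutral mult_less_cancel1)
    moreover have "coprime (p ^ multiplicity p n) r"
      using p(1) r(2) by (simp add: prime_imp_coprime)
    ultimately have "P (p ^ multiplicity p n * r)"
      using mult prime_power[OF p(1)] less.IH r0 p(1) by (simp add: prime_gt_0_nat)
    then show ?thesis using r(1) by simp
  qed
qed

section \<open>Solutions at prime powers\<close>

lemma sum_power_less_power:
  fixes p :: nat
  assumes "p \<ge> 2"
  shows "(\<Sum>i<k. p ^ i) < p ^ k"
proof (induction k)
  case (Suc k)
  have "(\<Sum>i<Suc k. p ^ i) < 2 * p ^ k" using Suc by simp
  also have "\<dots> \<le> p ^ Suc k" using assms by simp
  finally show ?case .
qed simp

text \<open>The elements of \<open>S\<close> are distinct powers \<open>p ^ i\<close> with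
  \<open>i < k\<close>, so a geometric sum dominates.\<close>

lemma sum_proper_divisors_prime_power_less:
  fixes p :: nat
  assumes "prime p" and "S \<subseteq> {d. d dvd p ^ k} - {p ^ k}"
  shows "\<Sum>S < p ^ k"
proof -
  have "S \<subseteq> (\<lambda>i. p ^ i) ` {..<k}"
  proof
    fix d assume "d \<in> S"
    then have "d dvd p ^ k" "d \<noteq> p ^ k" using assms(2) by auto
    then obtain i where "i \<le> k" "d = p ^ i"
      using divides_primepow_nat[OF assms(1)] by blast
    then show "d \<in> (\<lambda>i. p ^ i) ` {..<k}" using \<open>d \<noteq> p ^ k\<close> by (cases "i = k") auto
  qed
  then have "\<Sum>S \<le> \<Sum>((\<lambda>i. p ^ i) ` {..<k})" by (intro sum_mono2) auto
  also have "\<dots> = (\<Sum>i<k. p ^ i)"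
    using prime_gt_1_nat[OF assms(1)]
    by (subst sum.reindex) (auto simp: inj_on_def)
  also have "\<dots> < p ^ k"
    using sum_power_less_power prime_ge_2_nat[OF assms(1)] by blast
  finally show ?thesis .
qed

lemma divisor_system_dvd: "divisor_system A \<Longrightarrow> n > 0 \<Longrightarrow> d \<in> A n \<Longrightarrow> d dvd n"
  by (auto simp: divisor_system_def)

lemma divisor_system_finite: "divisor_system A \<Longrightarrow> n > 0 \<Longrightarrow> finite (A n)"
  by (rule finite_subset[of _ "{d. d dvd n}"]) (auto simp: divisor_system_def)

lemma totient_solution_split:
  assumes "divisor_system A" "totient_solution A \<phi>" "n > 0" "n \<in> A n"
  shows "\<phi> n = of_nat n - (\<Sum>d\<in>A n - {n}. \<phi> d)"
  using assms(2,3) sum.remove[OF divisor_system_finite[OF assms(1,3)] assms(4), of \<phi>]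
  by (simp add: totient_solution_def)

lemma totient_solution_prime_power:
  assumes A: "divisor_system A" and sol: "totient_solution A \<phi>" and p: "prime p"
  shows "p ^ k \<in> A (p ^ k) \<and> \<phi> (p ^ k) \<in> \<real> \<and> 1 \<le> Re (\<phi> (p ^ k)) \<and> Re (\<phi> (p ^ k)) \<le> real (p ^ k)"
proof (induction k rule: less_induct)
  case (less k)
  have pos: "p ^ k > 0" using p by (simp add: prime_gt_0_nat)
  define S where "S = A (p ^ k) - {p ^ k}"
  have S: "S \<subseteq> {d. d dvd p ^ k} - {p ^ k}"
    using divisor_system_dvd[OF A pos] by (auto simp: S_def)
  have bounds: "\<phi> d \<in> \<real> \<and> 1 \<le> Re (\<phi> d) \<and> Re (\<phi> d) \<le> real d" if "d \<in> S" for d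
  proof -
    have "d dvd p ^ k" "d \<noteq> p ^ k" using S that by auto
    then obtain i where "i \<le> k" "d = p ^ i"
      using divides_primepow_nat[OF p] by blast
    with \<open>d \<noteq> p ^ k\<close> have "i < k" by (cases "i = k") auto
    with less.IH \<open>d = p ^ i\<close> show ?thesis by blast
  qed
  have real: "(\<Sum>d\<in>S. \<phi> d) \<in> \<real>" using bounds by (intro sum_in_Reals) auto
  have nonneg: "Re (\<Sum>d\<in>S. \<phi> d) \<ge> 0"
    using bounds by (force intro: sum_nonneg)
  have "Re (\<Sum>d\<in>S. \<phi> d) \<le> (\<Sum>d\<in>S. real d)"
    using bounds by (auto intro: sum_mono)
  also have "\<dots> = real (\<Sum>S)" by simp
  finally have upper: "Re (\<Sum>d\<in>S. \<phi> d) \<le> real (\<Sum>S)" .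
  \<comment> \<open>Strict inequality of naturals gives a gap of at least 1; this gap becomes the
    lower bound for \<open>\<phi> (p ^ k)\<close>.\<close>
  have "\<Sum>S + 1 \<le> p ^ k"
    using sum_proper_divisors_prime_power_less[OF p S] by simp
  then have "real (\<Sum>S) + 1 \<le> real (p ^ k)"
    by (metis of_nat_1 of_nat_add of_nat_le_iff)
  with upper have upper: "Re (\<Sum>d\<in>S. \<phi> d) + 1 \<le> real (p ^ k)" by linarith
  have mem: "p ^ k \<in> A (p ^ k)"
  \<comment> \<open>Without \<open>p ^ k\<close>, the set \<open>S\<close> would be all of
    \<open>A (p ^ k)\<close>, too small to reach the required total.\<close>
  proof (rule ccontr)
    assume "p ^ k \<notin> A (p ^ k)"
    then have "(\<Sum>d\<in>S. \<phi> d) = of_nat (p ^ k)"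
      using sol pos unfolding S_def totient_solution_def by simp
    then show False using upper by (simp only: complex_Re_of_nat)
  qed
  have "\<phi> (p ^ k) = of_nat (p ^ k) - (\<Sum>d\<in>S. \<phi> d)"
    using totient_solution_split[OF A sol pos mem] by (simp add: S_def)
  then show ?case
    using mem real nonneg upper by (simp del: of_nat_power Re_sum)
qed

section \<open>Uniqueness and existence\<close>

lemma totient_solution_unique:
  assumes A: "divisor_system A" and self: "\<And>n. n > 0 \<Longrightarrow> n \<in> A n"
    and sol: "totient_solution A \<phi>" "totient_solution A \<psi>" and "n > 0"
  shows "\<psi> n = \<phi> n"
  using \<open>n > 0\<close>
proof (induction n rule: less_induct)
  case (less n)
  have "(\<Sum>d\<in>A n - {n}. \<psi> d) = (\<Sum>d\<in>A n - {n}. \<phi> d)"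
  proof (rule sum.cong)
    fix d assume "d \<in> A n - {n}"
    then have "d dvd n" "d \<noteq> n" using divisor_system_dvd[OF A less.prems] by auto
    then show "\<psi> d = \<phi> d"
      using less by (metis dvd_imp_le dvd_pos_nat le_neq_implies_less)
  qed simp
  then show ?case
    using totient_solution_split[OF A _ less.prems self[OF less.prems]] sol by metis
qed

text \<open>Cutting with \<open>{..<n}\<close> instead of removing \<open>n\<close> makes the
  recursion terminate for every \<open>A\<close>, even at \<open>0\<close> or when \<open>A\<close>
  is no divisor system.\<close>

function recursive_totient :: "(nat \<Rightarrow> nat set) \<Rightarrow> nat \<Rightarrow> complex" where
  "recursive_totient A n = of_nat n - (\<Sum>d\<in>A n \<inter> {..<n}. recursive_totient A d)"
  by auto
termination by (relation "measure snd") auto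

declare recursive_totient.simps [simp del]

lemma totient_solution_recursive_totient:
  assumes A: "divisor_system A" and self: "\<And>n. n > 0 \<Longrightarrow> n \<in> A n"
  shows "totient_solution A (recursive_totient A)"
  unfolding totient_solution_def
proof (intro allI impI)
  fix n :: nat assume n: "n > 0"
  have "A n \<inter> {..<n} = A n - {n}"
    using dvd_imp_le[OF divisor_system_dvd[OF A n] n] by (force simp: le_less)
  then show "(\<Sum>d\<in>A n. recursive_totient A d) = of_nat n"
    using divisor_system_finite[OF A n] self[OF n]
    by (simp add: sum.remove[of "A n" n] recursive_totient.simps[of A n])
qed

section \<open>Multiplicativity of solutions\<close>

lemma inj_on_mult_divisors_coprime:
  fixes m n :: nat
  assumes "coprime m n"
  shows "inj_on (\<lambda>(a, b). a * b) ({a. a dvd m} \<times> {b. b dvd n})"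
proof (rule inj_onI, clarsimp)
  fix a b c d :: nat
  assume *: "a dvd m" "b dvd n" "c dvd m" "d dvd n" "a * b = c * d"
  \<comment> \<open>Cross coprimality cancels the foreign factor: \<open>a dvd c * d\<close> yields
    \<open>a dvd c\<close>, and similarly for the other three divisibilities.\<close>
  have "coprime a d" "coprime c b"
    using * assms by (meson coprime_divisors)+
  moreover have "a dvd c * d" "c dvd a * b" "b dvd c * d" "d dvd a * b"
    using * by (metis dvd_triv_left dvd_triv_right)+
  ultimately show "a = c \<and> b = d"
    by (metis coprime_commute coprime_dvd_mult_left_iff coprime_dvd_mult_right_iff dvd_antisym)
qed

text \<open>Coprimality makes each element of \<open>A (m * n)\<close> a product in exactly one way,
  so the sum can be reindexed by pairs.\<close>

lemma multiplicative_divisor_system_sum: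
  fixes f :: "nat \<Rightarrow> 'a :: comm_monoid_add"
  assumes A: "multiplicative_divisor_system A" and "m > 0" "n > 0" "coprime m n"
  shows "(\<Sum>d\<in>A (m * n). f d) = (\<Sum>(a, b)\<in>A m \<times> A n. f (a * b))"
proof -
  have "A m \<times> A n \<subseteq> {a. a dvd m} \<times> {b. b dvd n}"
    using A assms(2,3) by (auto simp: multiplicative_divisor_system_def divisor_system_def)
  then have "inj_on (\<lambda>(a, b). a * b) (A m \<times> A n)"
    using inj_on_mult_divisors_coprime[OF assms(4)] inj_on_subset by blast
  moreover have "A (m * n) = (\<lambda>(a, b). a * b) ` (A m \<times> A n)"
    using assms unfolding multiplicative_divisor_system_def by auto
  ultimately show ?thesis
    by (simp add: sum.reindex case_prod_unfold)
qed

lemma totient_solution_mult: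
  assumes A: "multiplicative_divisor_system A" and self: "\<And>n. n > 0 \<Longrightarrow> n \<in> A n"
    and sol: "totient_solution A \<phi>" and "m > 0" "n > 0" "coprime m n"
  shows "\<phi> (m * n) = \<phi> m * \<phi> n"
  using assms(4-6)
proof (induction "m * n" arbitrary: m n rule: less_induct)
  case less
  note m = \<open>m > 0\<close> and n = \<open>n > 0\<close>
  have D: "divisor_system A" using A by (simp add: multiplicative_divisor_system_def)
  define S where "S = A m \<times> A n - {(m, n)}"
  have fin: "finite (A m \<times> A n)" "(m, n) \<in> A m \<times> A n"
    using divisor_system_finite[OF D] m n self by auto
  \<comment> \<open>The two full double sums both equal \<open>m * n\<close>; once they agree off
    \<open>(m, n)\<close>, the remaining terms must agree too.\<close>
  have "(\<Sum>(a, b)\<in>S. \<phi> (a * b)) = (\<Sum>(a, b)\<in>S. \<phi> a * \<phi> b)"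
  proof (rule sum.cong, simp, clarify)
    fix a b assume "(a, b) \<in> S"
    then have ab: "a dvd m" "b dvd n" "(a, b) \<noteq> (m, n)"
      using divisor_system_dvd[OF D] m n by (auto simp: S_def)
    then have pos: "a > 0" "b > 0" using m n by (auto intro: Nat.gr0I)
    have "a \<le> m" "b \<le> n" using ab m n by (auto dest: dvd_imp_le)
    \<comment> \<open>At least one of \<open>a < m\<close> and \<open>b < n\<close> is strict, hence
      the two monotonicity rules.\<close>
    then have "a * b < m * n"
      using ab(3) pos mult_le_less_imp_less[of a m b n] mult_less_le_imp_less[of a m b n]
      by (auto simp: le_less)
    moreover have "coprime a b" using ab less.prems by (meson coprime_divisors)
    ultimately show "\<phi> (a * b) = \<phi> a * \<phi> b" using less.hyps pos by blast
  qed
  moreover have "(\<Sum>(a, b)\<in>A m \<times> A n. \<phi> (a * b)) = of_nat (m * n)"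
    using multiplicative_divisor_system_sum[OF A less.prems, of \<phi>] sol m n
    by (simp add: totient_solution_def)
  moreover have "(\<Sum>(a, b)\<in>A m \<times> A n. \<phi> a * \<phi> b) = of_nat (m * n)"
    using sol m n
    by (simp add: totient_solution_def flip: sum.cartesian_product sum_product)
  ultimately show ?case
    using sum.remove[OF fin, of "\<lambda>(a, b). \<phi> (a * b)"] sum.remove[OF fin, of "\<lambda>(a, b). \<phi> a * \<phi> b"]
    by (simp add: S_def) (metis add_right_imp_eq)
qed

section \<open>From prime powers to all positive integers\<close>

lemma totient_solution_imp_self_mem:
  assumes A: "multiplicative_divisor_system A" and sol: "totient_solution A \<phi>" and "n > 0"
  shows "n \<in> A n"
  using \<open>n > 0\<close>
proof (induction n rule: coprime_prime_power_induct)
  case (prime_power p k)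
  then show ?case
    using A sol totient_solution_prime_power by (simp add: multiplicative_divisor_system_def)
next
  case (mult a b)
  then show ?case
    using A unfolding multiplicative_divisor_system_def by blast
qed

lemma totient_solution_bounds:
  assumes A: "multiplicative_divisor_system A" and sol: "totient_solution A \<phi>" and "n > 0"
  shows "\<phi> n \<in> \<real> \<and> 1 \<le> Re (\<phi> n) \<and> Re (\<phi> n) \<le> real n"
  using \<open>n > 0\<close>
proof (induction n rule: coprime_prime_power_induct)
  case (prime_power p k)
  then show ?case
    using A sol totient_solution_prime_power unfolding multiplicative_divisor_system_def by blast
next
  case (mult a b)
  have eq: "\<phi> (a * b) = \<phi> a * \<phi> b"
    using totient_solution_mult[OF A totient_solution_imp_self_mem[OF A sol] sol] mult by blast
  \<comment> \<open>Realness is carried through the induction because \<open>Re\<close> respects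
    products of real values.\<close>
  have "Re (\<phi> (a * b)) = Re (\<phi> a) * Re (\<phi> b)"
    using mult by (simp add: eq complex_is_Real_iff)
  moreover have "1 * 1 \<le> Re (\<phi> a) * Re (\<phi> b)"
    using mult by (intro mult_mono) auto
  moreover have "Re (\<phi> a) * Re (\<phi> b) \<le> real a * real b"
    using mult by (intro mult_mono) auto
  moreover have "\<phi> (a * b) \<in> \<real>"
    using mult by (simp add: eq)
  ultimately show ?case by simp
qed

theorem theorem5:
  fixes A :: "nat \<Rightarrow> nat set"
  assumes "multiplicative_divisor_system A"
  shows "((\<exists>\<phi>. totient_solution A \<phi>) \<longleftrightarrow> (\<forall>n>0. n \<in> A n)) \<and>
    ((\<forall>n>0. n \<in> A n) \<longrightarrow>
      (\<exists>\<phi>. totient_solution A \<phi> \<and>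
        (\<forall>\<psi>. totient_solution A \<psi> \<longrightarrow> (\<forall>n>0. \<psi> n = \<phi> n)) \<and>
        multiplicative_arith \<phi> \<and>
        (\<forall>n>0. \<phi> n \<in> \<real> \<and> 1 \<le> Re (\<phi> n) \<and> Re (\<phi> n) \<le> real n)))"
proof -
  have D: "divisor_system A"
    using assms by (simp add: multiplicative_divisor_system_def)
  have "multiplicative_arith \<phi>"
    if "\<forall>n>0. n \<in> A n" "totient_solution A \<phi>" for \<phi>
  proof -
    \<comment> \<open>The lower bound at \<open>1\<close> supplies the nonvanishing clause of
      \<open>multiplicative_arith\<close>.\<close>
    have "\<phi> 1 \<noteq> 0" using totient_solution_bounds[OF assms that(2), of 1] by auto
    then show ?thesis
      unfolding multiplicative_arith_def
      using totient_solution_mult[OF assms _ that(2)] that(1) zero_less_one by blast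
  qed
  then show ?thesis
    using totient_solution_imp_self_mem[OF assms] totient_solution_recursive_totient[OF D]
      totient_solution_unique[OF D] totient_solution_bounds[OF assms]
    by blast
qed

end
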